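(* Let $G$ be a finite group and $A$ a finite set of size $q \geq 2$. Then \[ \mathrm{Rank}(\mathrm{ICA}(G;A)) \geq \begin{cases} r(G) - r_2(G) & \text{if } q=2, \\ r(G) & \text{otherwise}. \end{cases} \]
   Context: For a finite group $G$, $r(G)$ is the total number of conjugacy classes of subgroups of $G$, and $r_i(G)$ is the number of conjugacy classes of subgroups $H\leq G$ with index $[G:H]=i$. For a group $G$ and a finite set $A$, $A^G$ is the set of all functions $x : G \to A$, with the shift action $(g\cdot x)(h) = x(g^{-1}h)$. A cellular automaton over $A^G$ is a map $\tau : A^G \to A^G$ for which there exist a finite subset $S \subseteq G$ and a function $\mu : A^S \to A$ such that $\tau(x)(g) = \mu((g^{-1}\cdot x)|_S)$ for all $x \in A^G$, $g\in G$. $\mathrm{CA}(G;A)$ is the monoid of all cellular automata over $A^G$ under composition, and $\mathrm{ICA}(G;A)$ is its group of units. For a monoid $M$, $\mathrm{Rank}(M)$ is the minimal cardinality of a subset $T \subseteq M$ generating $M$ as a monoid. *)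

theory Defs
  imports "HOL-Algebra.Group_Action" "HOL.Hull"
begin

(* Maps between sets are extensional: undefined outside of their domain,
   so that two maps are equal iff they agree on the domain. *)

definition configurations :: "('a, 'm) monoid_scheme \<Rightarrow> 'b set \<Rightarrow> ('a \<Rightarrow> 'b) set" where
  "configurations G A = carrier G \<rightarrow>\<^sub>E A"

definition shift :: "('a, 'm) monoid_scheme \<Rightarrow> 'a \<Rightarrow> ('a \<Rightarrow> 'b) \<Rightarrow> 'a \<Rightarrow> 'b" where
  "shift G g x = (\<lambda>h \<in> carrier G. x (inv\<^bsub>G\<^esub> g \<otimes>\<^bsub>G\<^esub> h))"

definition cellular_automaton ::
    "('a, 'm) monoid_scheme \<Rightarrow> 'b set \<Rightarrow> (('a \<Rightarrow> 'b) \<Rightarrow> 'a \<Rightarrow> 'b) \<Rightarrow> bool" where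
  "cellular_automaton G A \<tau> \<longleftrightarrow>
     \<tau> \<in> configurations G A \<rightarrow>\<^sub>E configurations G A \<and>
     (\<exists>S \<mu>. finite S \<and> S \<subseteq> carrier G \<and> \<mu> \<in> (S \<rightarrow>\<^sub>E A) \<rightarrow> A \<and>
        (\<forall>x \<in> configurations G A. \<forall>g \<in> carrier G.
           \<tau> x g = \<mu> (restrict (shift G (inv\<^bsub>G\<^esub> g) x) S)))"

definition CA :: "('a, 'm) monoid_scheme \<Rightarrow> 'b set \<Rightarrow> (('a \<Rightarrow> 'b) \<Rightarrow> 'a \<Rightarrow> 'b) monoid" where
  "CA G A =
     \<lparr>carrier = {\<tau>. cellular_automaton G A \<tau>},
      mult = compose (configurations G A),
      one = (\<lambda>x \<in> configurations G A. x)\<rparr>"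

definition ICA :: "('a, 'm) monoid_scheme \<Rightarrow> 'b set \<Rightarrow> (('a \<Rightarrow> 'b) \<Rightarrow> 'a \<Rightarrow> 'b) monoid" where
  "ICA G A = units_of (CA G A)"

definition generates_monoid :: "('a, 'm) monoid_scheme \<Rightarrow> 'a set \<Rightarrow> bool" where
  "generates_monoid M T \<longleftrightarrow>
     T \<subseteq> carrier M \<and> (\<lambda>N. submonoid N M) hull T = carrier M"

(* Meaningful for finitely generated monoids only (in particular for finite ones);
   otherwise the value of LEAST is unspecified. *)
definition monoid_rank :: "('a, 'm) monoid_scheme \<Rightarrow> nat" where
  "monoid_rank M = (LEAST n. \<exists>T. finite T \<and> card T = n \<and> generates_monoid M T)"

definition subgroup_conjugation :: "('a, 'm) monoid_scheme \<Rightarrow> 'a \<Rightarrow> 'a set \<Rightarrow> 'a set" where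
  "subgroup_conjugation G =
     (\<lambda>g. \<lambda>H \<in> {H. subgroup H G}. g <#\<^bsub>G\<^esub> H #>\<^bsub>G\<^esub> inv\<^bsub>G\<^esub> g)"

definition num_subgroup_classes :: "('a, 'm) monoid_scheme \<Rightarrow> nat" where
  "num_subgroup_classes G =
     card (orbits G {H. subgroup H G} (subgroup_conjugation G))"

definition num_subgroup_classes_index :: "('a, 'm) monoid_scheme \<Rightarrow> nat \<Rightarrow> nat" where
  "num_subgroup_classes_index G i =
     card (orbits G {H. subgroup H G \<and> card (rcosets\<^bsub>G\<^esub> H) = i} (subgroup_conjugation G))"

end

(* An invertible cellular automaton commutes with the shift and preserves stabilizers, so for each
   conjugacy class c of subgroups it permutes the orbits of configurations whose stabilizers lie
   in c; the parity of this permutation is a homomorphism to Z/2. If c contains two distinct such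
   orbits through x and y with the same stabilizer H, exchanging g x with g y for all g gives an
   automaton that is odd at c and even at every other class. So the parities map ICA(G;A) onto a
   power of Z/2 with one factor for each such class, and a generating set needs at least as many
   elements as there are factors. The orbits exist unless q = 2 and [G:H] = 2: take configurations
   that are constant on H and constant off H. *)
theory Submission
  imports Defs "HOL-Combinatorics.Permutations"
begin

section \<open>Parity homomorphisms and the size of generating sets\<close>

text \<open>The \<open>p c\<close> together form a homomorphism to (Z/2)^C, onto by
  \<open>dual\<close>. Multiplicities of generators matter only mod 2, so every value is the sum of
  the images of some subset of \<open>T\<close>; hence 2^|C| <= 2^|T|.\<close>

lemma card_generators_ge_independent_parities:
  fixes p :: "'c \<Rightarrow> 'x \<Rightarrow> bool"
  assumes M: "monoid M" and T: "finite T" "generates_monoid M T" and C: "finite C"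
    and mult: "\<And>c x y. c \<in> C \<Longrightarrow> x \<in> carrier M \<Longrightarrow> y \<in> carrier M \<Longrightarrow>
                  p c (x \<otimes>\<^bsub>M\<^esub> y) \<longleftrightarrow> (p c x \<noteq> p c y)"
    and dual: "\<And>c. c \<in> C \<Longrightarrow> \<exists>x\<in>carrier M. \<forall>d\<in>C. p d x \<longleftrightarrow> d = c"
  shows "card C \<le> card T"
proof -
  interpret monoid M by (rule M)
  \<comment> \<open>Elements of (Z/2)^C are encoded as subsets of \<open>C\<close>, with symmetric
    difference as addition. \<open>\<Phi> x\<close> is the image of \<open>x\<close>, and
    \<open>parity U\<close> is the sum of the images of the elements of \<open>U\<close>.\<close>
  define \<Phi> where "\<Phi> x = {c \<in> C. p c x}" for x
  define parity where "parity U = {c \<in> C. odd (card {t \<in> U. p c t})}" for U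
  have p_one: "\<not> p c \<one>\<^bsub>M\<^esub>" if "c \<in> C" for c
    using mult[OF that one_closed one_closed] by simp
  have "submonoid {x \<in> carrier M. \<Phi> x \<in> parity ` Pow T} M"
  proof
    show "\<one>\<^bsub>M\<^esub> \<in> {x \<in> carrier M. \<Phi> x \<in> parity ` Pow T}"
      using p_one by (auto simp: \<Phi>_def parity_def intro!: image_eqI[of _ _ "{}"])
  next
    fix x y
    assume "x \<in> {x \<in> carrier M. \<Phi> x \<in> parity ` Pow T}"
      and "y \<in> {x \<in> carrier M. \<Phi> x \<in> parity ` Pow T}"
    then obtain U V where x: "x \<in> carrier M" "U \<subseteq> T" "\<Phi> x = parity U"
      and y: "y \<in> carrier M" "V \<subseteq> T" "\<Phi> y = parity V" by auto
    have fin: "finite U" "finite V"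
      using x(2) y(2) T(1) finite_subset by auto
    \<comment> \<open>Generators common to \<open>U\<close> and \<open>V\<close> contribute twice
      and cancel mod 2, so the symmetric difference represents the product.\<close>
    define W where "W = (U - V) \<union> (V - U)"
    have odd_W: "odd (card {t \<in> W. p c t}) \<longleftrightarrow>
        (odd (card {t \<in> U. p c t}) \<noteq> odd (card {t \<in> V. p c t}))" for c
    proof -
      let ?U = "{t \<in> U. p c t}" and ?V = "{t \<in> V. p c t}"
      have "{t \<in> W. p c t} = (?U - ?V) \<union> (?V - ?U)"
        unfolding W_def by auto
      then have "card {t \<in> W. p c t} = card (?U - ?V) + card (?V - ?U)"
        using fin by (simp only:) (subst card_Un_disjoint, auto)
      moreover have "card ?U = card (?U - ?V) + card (?U \<inter> ?V)"
        and "card ?V = card (?V - ?U) + card (?U \<inter> ?V)"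
        using fin by (auto simp: card_Diff_subset_Int Int_commute card_mono add.commute)
      ultimately show ?thesis by auto
    qed
    have "c \<in> \<Phi> (x \<otimes>\<^bsub>M\<^esub> y) \<longleftrightarrow> c \<in> parity W" for c
    proof -
      have "c \<in> \<Phi> (x \<otimes>\<^bsub>M\<^esub> y) \<longleftrightarrow> c \<in> C \<and> (c \<in> \<Phi> x) \<noteq> (c \<in> \<Phi> y)"
        using mult[OF _ x(1) y(1)] by (auto simp: \<Phi>_def)
      then show ?thesis
        using odd_W unfolding x(3) y(3) by (auto simp: parity_def)
    qed
    then have "\<Phi> (x \<otimes>\<^bsub>M\<^esub> y) = parity W" by blast
    moreover have "W \<subseteq> T" using x(2) y(2) unfolding W_def by blast
    ultimately show "x \<otimes>\<^bsub>M\<^esub> y \<in> {x \<in> carrier M. \<Phi> x \<in> parity ` Pow T}"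
      using x(1) y(1) by blast
  qed auto
  moreover have "T \<subseteq> {x \<in> carrier M. \<Phi> x \<in> parity ` Pow T}"
  proof
    fix t assume t: "t \<in> T"
    have "{s \<in> {t}. p c s} = (if p c t then {t} else {})" for c by auto
    then have "\<Phi> t = parity {t}"
      by (auto simp: \<Phi>_def parity_def)
    with t T(2) show "t \<in> {x \<in> carrier M. \<Phi> x \<in> parity ` Pow T}"
      by (auto simp: generates_monoid_def)
  qed
  ultimately have "(\<lambda>N. submonoid N M) hull T \<subseteq> {x \<in> carrier M. \<Phi> x \<in> parity ` Pow T}"
    by (intro hull_minimal)
  then have upper: "\<Phi> ` carrier M \<subseteq> parity ` Pow T"
    using T(2) by (auto simp: generates_monoid_def)
  \<comment> \<open>Surjectivity: any \<open>D\<close> is reached by multiplying the elements dual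
    to its members.\<close>
  have "\<exists>x\<in>carrier M. \<Phi> x = D" if "finite D" "D \<subseteq> C" for D
    using that
  proof (induction D)
    case empty
    then show ?case using p_one by (auto simp: \<Phi>_def)
  next
    case (insert c D)
    then obtain x where x: "x \<in> carrier M" "\<Phi> x = D" by auto
    obtain y where y: "y \<in> carrier M" "\<forall>d\<in>C. p d y \<longleftrightarrow> d = c"
      using dual insert.prems by blast
    have "\<Phi> (x \<otimes>\<^bsub>M\<^esub> y) = insert c D"
      using x y insert.hyps insert.prems mult[OF _ x(1) y(1)] by (auto simp: \<Phi>_def)
    with x y show ?case by blast
  qed
  then have "Pow C \<subseteq> \<Phi> ` carrier M"
    using C finite_subset by (metis (no_types, lifting) PowD image_eqI subsetI)
  then have "card (Pow C) \<le> card (parity ` Pow T)"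
    using upper T(1) by (intro card_mono) auto
  also have "\<dots> \<le> card (Pow T)"
    using T(1) by (intro card_image_le) auto
  finally show ?thesis
    using C T(1) by (simp add: card_Pow)
qed

text \<open>The whole carrier is a finite generating set, so \<open>LEAST\<close> ranges over a
  nonempty set and its value is a genuine minimum.\<close>

lemma monoid_rank_attained:
  assumes "monoid M" and "finite (carrier M)"
  obtains T where "finite T" "card T = monoid_rank M" "generates_monoid M T"
proof -
  interpret monoid M by fact
  have "submonoid (carrier M) M" by unfold_locales auto
  then have "generates_monoid M (carrier M)"
    by (simp add: generates_monoid_def hull_same[of "\<lambda>N. submonoid N M"])
  then have "\<exists>n T. finite T \<and> card T = n \<and> generates_monoid M T"
    using assms(2) by blast
  from LeastI_ex[OF this] that show thesis
    unfolding monoid_rank_def by blast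
qed

section \<open>The shift action and cellular automata as equivariant maps\<close>

text \<open>For finite \<open>G\<close> these are exactly the cellular automata, as in the
  Curtis-Hedlund theorem; see \<open>carrier_CA\<close>.\<close>

definition equivariant_maps ::
    "('a, 'm) monoid_scheme \<Rightarrow> 'b set \<Rightarrow> (('a \<Rightarrow> 'b) \<Rightarrow> 'a \<Rightarrow> 'b) set" where
  "equivariant_maps G A =
     {\<tau> \<in> configurations G A \<rightarrow>\<^sub>E configurations G A.
        \<forall>g\<in>carrier G. \<forall>x\<in>configurations G A. \<tau> (shift G g x) = shift G g (\<tau> x)}"

context group
begin

lemma shift_closed:
  "g \<in> carrier G \<Longrightarrow> x \<in> configurations G A \<Longrightarrow> shift G g x \<in> configurations G A"
  by (auto simp: shift_def configurations_def PiE_def Pi_def)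

lemma shift_shift:
  "g \<in> carrier G \<Longrightarrow> h \<in> carrier G \<Longrightarrow> shift G g (shift G h x) = shift G (g \<otimes> h) x"
  by (simp add: shift_def inv_mult_group m_assoc fun_eq_iff)

lemma shift_one: "x \<in> configurations G A \<Longrightarrow> shift G \<one> x = x"
  by (auto simp: shift_def configurations_def PiE_def extensional_def fun_eq_iff)

lemma shift_inv_shift:
  "g \<in> carrier G \<Longrightarrow> x \<in> configurations G A \<Longrightarrow> shift G (inv g) (shift G g x) = x"
  "g \<in> carrier G \<Longrightarrow> x \<in> configurations G A \<Longrightarrow> shift G g (shift G (inv g) x) = x"
  by (simp_all add: shift_shift shift_one)

text \<open>Two elements move \<open>x\<close> to the same point iff they lie in the same left coset
  of its stabilizer. Thus configurations with equal stabilizers have the same coincidences among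
  their shifts, which later makes the exchange of two orbits well defined.\<close>

lemma shift_eq_shift_iff:
  assumes "g \<in> carrier G" "h \<in> carrier G" "x \<in> configurations G A"
  shows "shift G g x = shift G h x \<longleftrightarrow> inv h \<otimes> g \<in> stabilizer G (shift G) x"
proof
  assume "shift G g x = shift G h x"
  then have "shift G (inv h) (shift G g x) = x"
    using assms by (simp add: shift_inv_shift)
  then show "inv h \<otimes> g \<in> stabilizer G (shift G) x"
    using assms by (simp add: stabilizer_def shift_shift)
next
  assume "inv h \<otimes> g \<in> stabilizer G (shift G) x"
  then have "shift G h (shift G (inv h \<otimes> g) x) = shift G h x"
    by (simp add: stabilizer_def)
  moreover have "h \<otimes> (inv h \<otimes> g) = g"
    using assms by (simp add: m_assoc[symmetric])
  ultimately show "shift G g x = shift G h x"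
    using assms by (simp add: shift_shift)
qed

text \<open>An element k fixes g x iff its conjugate g^-1 k g fixes x. The hypothesis
  \<open>H\<close> gives access to the body of \<open>subgroup_conjugation\<close>, which is
  \<open>undefined\<close> off the subgroups.\<close>

lemma stabilizer_shift:
  assumes g: "g \<in> carrier G" and x: "x \<in> configurations G A"
    and H: "subgroup (stabilizer G (shift G) x) G"
  shows "stabilizer G (shift G) (shift G g x)
           = subgroup_conjugation G g (stabilizer G (shift G) x)"
proof -
  have "k \<in> stabilizer G (shift G) (shift G g x)
          \<longleftrightarrow> (\<exists>h\<in>stabilizer G (shift G) x. k = g \<otimes> h \<otimes> inv g)" (is "?l \<longleftrightarrow> ?r")
    for k
  proof
    assume ?l
    then have k: "k \<in> carrier G" "shift G (k \<otimes> g) x = shift G g x"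
      using g by (auto simp: stabilizer_def shift_shift)
    then have "inv g \<otimes> (k \<otimes> g) \<in> stabilizer G (shift G) x"
      using g x by (subst shift_eq_shift_iff[symmetric]) auto
    moreover have "k = g \<otimes> (inv g \<otimes> (k \<otimes> g)) \<otimes> inv g"
      using g k(1) by (metis conjugation_is_surj m_assoc inv_closed)
    ultimately show ?r by blast
  next
    assume ?r
    then obtain h where h: "h \<in> carrier G" "shift G h x = x" "k = g \<otimes> h \<otimes> inv g"
      by (auto simp: stabilizer_def)
    have "shift G k (shift G g x) = shift G (g \<otimes> h) x"
      using g h by (simp add: shift_shift m_assoc)
    also have "\<dots> = shift G g (shift G h x)"
      using g h(1) by (simp only: shift_shift)
    finally have "shift G k (shift G g x) = shift G g x"
      using h(2) by simp
    with h g show ?l by (simp add: stabilizer_def)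
  qed
  then show ?thesis
    using H by (auto simp: subgroup_conjugation_def l_coset_def r_coset_def)
qed

lemma orbit_shift_refl: "x \<in> configurations G A \<Longrightarrow> x \<in> orbit G (shift G) x"
  using shift_one[of x A] one_closed unfolding orbit_def by (metis (mono_tags) mem_Collect_eq)

lemma orbit_shift_subset: "x \<in> configurations G A \<Longrightarrow> orbit G (shift G) x \<subseteq> configurations G A"
  by (auto simp: orbit_def shift_closed)

lemma orbit_shift_eq:
  assumes x: "x \<in> configurations G A" and y: "y \<in> orbit G (shift G) x"
  shows "orbit G (shift G) y = orbit G (shift G) x"
proof -
  have sub: "orbit G (shift G) (shift G g z) \<subseteq> orbit G (shift G) z"
    if "g \<in> carrier G" "z \<in> configurations G A" for g z
    using that by (auto simp: orbit_def shift_shift)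
  from y obtain g where g: "g \<in> carrier G" "y = shift G g x"
    by (auto simp: orbit_def)
  then have "x = shift G (inv g) y" "y \<in> configurations G A"
    using x by (simp_all add: shift_inv_shift shift_closed)
  then have "orbit G (shift G) x \<subseteq> orbit G (shift G) y"
    using sub[of "inv g" y] g(1) by simp
  moreover have "orbit G (shift G) y \<subseteq> orbit G (shift G) x"
    using sub[of g x] g x by simp
  ultimately show ?thesis by blast
qed

text \<open>A local rule sees only the translated pattern, so it commutes with shifts. Conversely,
  equivariance recovers \<open>\<tau> x g\<close> from the value at \<open>\<one>\<close> of the
  image of the translate by \<open>inv g\<close>; since \<open>G\<close> is finite, all of it can
  serve as memory set.\<close>

lemma carrier_CA:
  assumes fin: "finite (carrier G)"
  shows "carrier (CA G A) = equivariant_maps G A"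
proof (intro subset_antisym subsetI)
  fix \<tau> assume "\<tau> \<in> carrier (CA G A)"
  then obtain S \<mu> where \<tau>: "\<tau> \<in> configurations G A \<rightarrow>\<^sub>E configurations G A"
    and eq: "\<And>x g. x \<in> configurations G A \<Longrightarrow> g \<in> carrier G \<Longrightarrow>
               \<tau> x g = \<mu> (restrict (shift G (inv g) x) S)"
    by (auto simp: CA_def cellular_automaton_def)
  have "\<tau> (shift G g x) = shift G g (\<tau> x)"
    if g: "g \<in> carrier G" and x: "x \<in> configurations G A" for g x
  proof (rule extensionalityI)
    show "\<tau> (shift G g x) \<in> extensional (carrier G)"
      using \<tau> shift_closed[OF g x] by (auto simp: configurations_def PiE_def Pi_def)
    show "shift G g (\<tau> x) \<in> extensional (carrier G)"
      by (simp add: shift_def)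
    fix h assume h: "h \<in> carrier G"
    \<comment> \<open>The rule at \<open>h\<close> for the shifted configuration reads the same
      pattern as the rule at \<open>inv g \<otimes> h\<close> for \<open>x\<close>.\<close>
    have "shift G (inv h) (shift G g x) = shift G (inv (inv g \<otimes> h)) x"
      using g h by (simp add: shift_shift inv_mult_group)
    then show "\<tau> (shift G g x) h = shift G g (\<tau> x) h"
      using g h x by (simp add: eq shift_closed) (simp add: shift_def eq)
  qed
  with \<tau> show "\<tau> \<in> equivariant_maps G A"
    by (simp add: equivariant_maps_def)
next
  fix \<tau> assume \<tau>: "\<tau> \<in> equivariant_maps G A"
  then have maps: "\<tau> x \<in> configurations G A" if "x \<in> configurations G A" for x
    using that by (auto simp: equivariant_maps_def)
  have eq: "\<tau> x g = \<tau> (restrict (shift G (inv g) x) (carrier G)) \<one>"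
    if g: "g \<in> carrier G" and x: "x \<in> configurations G A" for g x
  proof -
    have "restrict (shift G (inv g) x) (carrier G) = shift G (inv g) x"
      by (simp add: shift_def)
    then show ?thesis
      using \<tau> g x by (simp add: equivariant_maps_def) (simp add: shift_def)
  qed
  have "(\<lambda>z. \<tau> z \<one>) \<in> (carrier G \<rightarrow>\<^sub>E A) \<rightarrow> A"
    using maps by (auto simp: configurations_def)
  then have "\<exists>S \<mu>. finite S \<and> S \<subseteq> carrier G \<and> \<mu> \<in> (S \<rightarrow>\<^sub>E A) \<rightarrow> A \<and>
        (\<forall>x \<in> configurations G A. \<forall>g \<in> carrier G.
           \<tau> x g = \<mu> (restrict (shift G (inv g) x) S))"
    using fin eq by (intro exI[of _ "carrier G"] exI[of _ "\<lambda>z. \<tau> z \<one>"]) simp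
  with \<tau> show "\<tau> \<in> carrier (CA G A)"
    by (simp add: CA_def cellular_automaton_def equivariant_maps_def)
qed

text \<open>Closure under composition is checked through equivariance, avoiding any composition of
  local rules.\<close>

lemma monoid_CA:
  assumes "finite (carrier G)"
  shows "monoid (CA G A)"
proof -
  have one: "(\<lambda>x \<in> configurations G A. x) \<in> equivariant_maps G A"
    by (simp add: equivariant_maps_def shift_closed)
  have mult: "compose (configurations G A) \<sigma> \<tau> \<in> equivariant_maps G A"
    if "\<sigma> \<in> equivariant_maps G A" "\<tau> \<in> equivariant_maps G A" for \<sigma> \<tau>
  proof -
    have "\<tau> x \<in> configurations G A" "\<sigma> x \<in> configurations G A"
      if "x \<in> configurations G A" for x
      using that \<open>\<sigma> \<in> _\<close> \<open>\<tau> \<in> _\<close> by (auto simp: equivariant_maps_def)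
    with that show ?thesis
      by (simp add: equivariant_maps_def compose_def shift_closed)
  qed
  have funcset: "\<tau> \<in> configurations G A \<rightarrow> configurations G A"
    "\<tau> \<in> extensional (configurations G A)" if "\<tau> \<in> equivariant_maps G A" for \<tau>
    using that by (auto simp: equivariant_maps_def PiE_def)
  have simps: "carrier (CA G A) = equivariant_maps G A"
    "(\<otimes>\<^bsub>CA G A\<^esub>) = compose (configurations G A)"
    "\<one>\<^bsub>CA G A\<^esub> = (\<lambda>x \<in> configurations G A. x)"
    using carrier_CA[OF assms] by (simp_all add: CA_def)
  show ?thesis
    by (rule monoidI; unfold simps)
       (simp_all add: one mult funcset compose_assoc[symmetric] Id_compose compose_Id[OF funcset])
qed

lemma ICA_simps:
  "carrier (ICA G A) = Units (CA G A)"
  "(\<otimes>\<^bsub>ICA G A\<^esub>) = compose (configurations G A)"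
  "one (ICA G A) = (\<lambda>x \<in> configurations G A. x)"
  by (simp_all add: ICA_def units_of_def CA_def)

lemma monoid_ICA: "finite (carrier G) \<Longrightarrow> monoid (ICA G A)"
  unfolding ICA_def using group.is_monoid monoid.units_group monoid_CA by blast

lemma finite_configurations:
  "finite (carrier G) \<Longrightarrow> finite A \<Longrightarrow> finite (configurations G A)"
  by (simp add: configurations_def finite_PiE)

lemma finite_ICA:
  assumes "finite (carrier G)" "finite A"
  shows "finite (carrier (ICA G A))"
proof (rule finite_subset)
  show "carrier (ICA G A) \<subseteq> configurations G A \<rightarrow>\<^sub>E configurations G A"
    using carrier_CA[OF assms(1)] by (auto simp: ICA_simps Units_def equivariant_maps_def)
  show "finite (configurations G A \<rightarrow>\<^sub>E configurations G A)"
    using finite_configurations[OF assms] by (simp add: finite_PiE)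
qed

lemma ICA_D:
  assumes "finite (carrier G)" "\<tau> \<in> carrier (ICA G A)"
  shows "x \<in> configurations G A \<Longrightarrow> \<tau> x \<in> configurations G A"
    and "g \<in> carrier G \<Longrightarrow> x \<in> configurations G A \<Longrightarrow> \<tau> (shift G g x) = shift G g (\<tau> x)"
    and "inj_on \<tau> (configurations G A)"
proof -
  obtain \<sigma> where \<tau>: "\<tau> \<in> equivariant_maps G A"
    and \<sigma>: "compose (configurations G A) \<sigma> \<tau> = (\<lambda>x \<in> configurations G A. x)"
    using assms carrier_CA[OF assms(1)] by (auto simp: ICA_simps Units_def CA_def)
  show "x \<in> configurations G A \<Longrightarrow> \<tau> x \<in> configurations G A"
    and "g \<in> carrier G \<Longrightarrow> x \<in> configurations G A \<Longrightarrow> \<tau> (shift G g x) = shift G g (\<tau> x)"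
    using \<tau> by (auto simp: equivariant_maps_def)
  have "\<sigma> (\<tau> z) = z" if "z \<in> configurations G A" for z
    using fun_cong[OF \<sigma>, of z] that by (simp add: compose_def)
  then show "inj_on \<tau> (configurations G A)"
    by (metis inj_onI)
qed

text \<open>By equivariance g fixes \<open>\<tau> x\<close> iff \<open>\<tau>\<close> sends g x and
  x to the same point, which by injectivity means g x = x.\<close>

lemma stabilizer_ICA:
  assumes "finite (carrier G)" "\<tau> \<in> carrier (ICA G A)" "x \<in> configurations G A"
  shows "stabilizer G (shift G) (\<tau> x) = stabilizer G (shift G) x"
proof -
  have "shift G g (\<tau> x) = \<tau> x \<longleftrightarrow> shift G g x = x" if "g \<in> carrier G" for g
    using ICA_D[OF assms(1,2)] that assms(3)
    by (metis inj_onD shift_closed)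
  then show ?thesis by (auto simp: stabilizer_def)
qed

end

section \<open>Permutations induced on orbits of a given stabilizer type\<close>

text \<open>One point with stabilizer in \<open>c\<close> puts its orbit here; when \<open>c\<close>
  is a conjugacy class, all points of the orbit then have this property.\<close>

definition orbits_of_type ::
    "('a, 'm) monoid_scheme \<Rightarrow> 'b set \<Rightarrow> 'a set set \<Rightarrow> ('a \<Rightarrow> 'b) set set" where
  "orbits_of_type G A c =
     orbits G {x \<in> configurations G A. stabilizer G (shift G) x \<in> c} (shift G)"

text \<open>The extension by the identity gives a map on the whole type, as
  \<open>permutation\<close> and \<open>evenperm\<close> expect.\<close>

definition induced_perm ::
    "('a, 'm) monoid_scheme \<Rightarrow> 'b set \<Rightarrow> 'a set set \<Rightarrow>
     (('a \<Rightarrow> 'b) \<Rightarrow> 'a \<Rightarrow> 'b) \<Rightarrow> ('a \<Rightarrow> 'b) set \<Rightarrow> ('a \<Rightarrow> 'b) set" where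
  "induced_perm G A c \<tau> P = (if P \<in> orbits_of_type G A c then \<tau> ` P else P)"

definition two_valued :: "('a, 'm) monoid_scheme \<Rightarrow> 'a set \<Rightarrow> 'b \<Rightarrow> 'b \<Rightarrow> 'a \<Rightarrow> 'b" where
  "two_valued G H a b = (\<lambda>h\<in>carrier G. if h \<in> H then a else b)"

context group
begin

lemma orbits_of_type_iff:
  "P \<in> orbits_of_type G A c \<longleftrightarrow>
     (\<exists>x\<in>configurations G A. stabilizer G (shift G) x \<in> c \<and> P = orbit G (shift G) x)"
  by (auto simp: orbits_of_type_def orbits_def)

lemma image_orbit_ICA:
  assumes "finite (carrier G)" "\<tau> \<in> carrier (ICA G A)" "x \<in> configurations G A"
  shows "\<tau> ` orbit G (shift G) x = orbit G (shift G) (\<tau> x)"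
  using ICA_D(2)[OF assms(1,2) _ assms(3)] by (force simp: orbit_def)

lemma image_orbits_of_type:
  assumes "finite (carrier G)" "\<tau> \<in> carrier (ICA G A)" "P \<in> orbits_of_type G A c"
  shows "\<tau> ` P \<in> orbits_of_type G A c"
proof -
  obtain x where x: "x \<in> configurations G A" "stabilizer G (shift G) x \<in> c"
      "P = orbit G (shift G) x"
    using assms(3) by (auto simp: orbits_of_type_iff)
  then show ?thesis
    unfolding orbits_of_type_iff x(3) image_orbit_ICA[OF assms(1,2) x(1)]
    using ICA_D(1)[OF assms(1,2) x(1)] stabilizer_ICA[OF assms(1,2) x(1)] x(2)
    by (intro bexI[of _ "\<tau> x"]) simp_all
qed

lemma orbits_of_type_subset: "P \<in> orbits_of_type G A c \<Longrightarrow> P \<subseteq> configurations G A"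
  using orbit_shift_subset by (auto simp: orbits_of_type_iff)

text \<open>\<open>\<sigma>\<close> sends orbits of type \<open>c\<close> to orbits of type
  \<open>c\<close>, so the case distinction in \<open>induced_perm\<close> falls the same way for
  both factors.\<close>

lemma induced_perm_mult:
  assumes "finite (carrier G)" "\<tau> \<in> carrier (ICA G A)" "\<sigma> \<in> carrier (ICA G A)"
  shows "induced_perm G A c (\<tau> \<otimes>\<^bsub>ICA G A\<^esub> \<sigma>) = induced_perm G A c \<tau> \<circ> induced_perm G A c \<sigma>"
proof
  fix P
  have "compose (configurations G A) \<tau> \<sigma> ` P = \<tau> ` \<sigma> ` P"
    if "P \<in> orbits_of_type G A c"
    using orbits_of_type_subset[OF that] by (force simp: compose_def image_image)
  then show "induced_perm G A c (\<tau> \<otimes>\<^bsub>ICA G A\<^esub> \<sigma>) P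
               = (induced_perm G A c \<tau> \<circ> induced_perm G A c \<sigma>) P"
    using image_orbits_of_type[OF assms(1,3)] by (simp add: induced_perm_def ICA_simps)
qed

lemma induced_perm_one: "induced_perm G A c \<one>\<^bsub>ICA G A\<^esub> = id"
proof
  fix P
  have "(\<lambda>x \<in> configurations G A. x) ` P = P" if "P \<in> orbits_of_type G A c"
    using orbits_of_type_subset[OF that] by force
  then show "induced_perm G A c \<one>\<^bsub>ICA G A\<^esub> P = id P"
    by (simp add: induced_perm_def ICA_simps)
qed

text \<open>The inverse automaton induces the inverse map, and only sets of configurations, finitely
  many, can be moved.\<close>

lemma permutation_induced_perm:
  assumes "finite (carrier G)" "finite A" "\<tau> \<in> carrier (ICA G A)"
  shows "permutation (induced_perm G A c \<tau>)"
  unfolding permutation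
proof
  interpret I: group "ICA G A"
    unfolding ICA_def by (rule monoid.units_group[OF monoid_CA[OF assms(1)]])
  have inv: "inv\<^bsub>ICA G A\<^esub> \<tau> \<in> carrier (ICA G A)"
    using assms(3) by simp
  show "bij (induced_perm G A c \<tau>)"
    by (rule o_bij[of "induced_perm G A c (inv\<^bsub>ICA G A\<^esub> \<tau>)"])
       (use assms(3) inv in \<open>simp_all add: induced_perm_one
          induced_perm_mult[OF assms(1), symmetric]\<close>)
  have "{P. induced_perm G A c \<tau> P \<noteq> P} \<subseteq> Pow (configurations G A)"
  proof
    fix P assume "P \<in> {P. induced_perm G A c \<tau> P \<noteq> P}"
    then have "P \<in> orbits_of_type G A c" by (auto simp: induced_perm_def split: if_splits)
    then show "P \<in> Pow (configurations G A)" by (simp add: orbits_of_type_subset)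
  qed
  then show "finite {P. induced_perm G A c \<tau> P \<noteq> P}"
    using finite_configurations[OF assms(1,2)] by (meson finite_Pow_iff finite_subset)
qed

section \<open>Conjugacy classes of subgroups and automata exchanging two orbits\<close>

lemma subgroup_conjugation_action:
  "group_action G {H. subgroup H G} (subgroup_conjugation G)"
  unfolding subgroup_conjugation_def by (rule action_by_conjugation_on_subgroups_set)

lemma subgroup_class_closed:
  assumes c: "c \<in> orbits G {H. subgroup H G} (subgroup_conjugation G)"
    and K: "K \<in> c" and g: "g \<in> carrier G"
  shows "subgroup K G" "subgroup_conjugation G g K \<in> c"
proof -
  interpret conj: group_action G "{H. subgroup H G}" "subgroup_conjugation G"
    by (rule subgroup_conjugation_action)
  obtain H where H: "subgroup H G" "c = orbit G (subgroup_conjugation G) H"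
    using c by (auto simp: orbits_def)
  obtain h where h: "h \<in> carrier G" "K = subgroup_conjugation G h H"
    using K H(2) by (auto simp: orbit_def)
  show "subgroup K G"
    using conj.element_image[OF h(1), of H K] H(1) h(2) by simp
  have "subgroup_conjugation G g K = subgroup_conjugation G (g \<otimes> h) H"
    using conj.composition_rule[of H g h] H(1) g h by simp
  then show "subgroup_conjugation G g K \<in> c"
    using H(2) g h(1) by (auto simp: orbit_def)
qed

text \<open>Shifting \<open>z\<close> back to \<open>x\<close> conjugates the stabilizer, and
  \<open>c\<close> is closed under conjugation.\<close>

lemma stabilizer_in_subgroup_class:
  assumes c: "c \<in> orbits G {H. subgroup H G} (subgroup_conjugation G)"
    and x: "x \<in> configurations G A" and z: "z \<in> orbit G (shift G) x"
    and stab: "stabilizer G (shift G) z \<in> c"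
  shows "stabilizer G (shift G) x \<in> c"
proof -
  obtain g where g: "g \<in> carrier G" "z = shift G g x"
    using z by (auto simp: orbit_def)
  then have "shift G (inv g) z = x" "z \<in> configurations G A"
    using x by (simp_all add: shift_inv_shift shift_closed)
  moreover have "subgroup (stabilizer G (shift G) z) G"
    by (rule subgroup_class_closed(1)[OF c stab g(1)])
  ultimately show ?thesis
    using stabilizer_shift[of "inv g" z A] subgroup_class_closed(2)[OF c stab, of "inv g"] g(1)
    by simp
qed

lemma exists_orbit_swap:
  fixes A :: "'c set"
  assumes fin: "finite (carrier G)"
    and x: "x \<in> configurations G A" and y: "y \<in> configurations G A"
    and stab: "stabilizer G (shift G) x = stabilizer G (shift G) y"
    and ne: "orbit G (shift G) x \<noteq> orbit G (shift G) y"
  obtains \<tau> where "\<tau> \<in> carrier (ICA G A)"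
    and "\<tau> x = y" and "\<tau> y = x"
    and "\<And>z. z \<in> configurations G A \<Longrightarrow> z \<notin> orbit G (shift G) x \<Longrightarrow>
           z \<notin> orbit G (shift G) y \<Longrightarrow> \<tau> z = z"
proof -
  let ?X = "configurations G A" and ?O = "\<lambda>z. orbit G (shift G) z"
  \<comment> \<open>\<open>SOME\<close> picks any element carrying \<open>u\<close> to
    \<open>z\<close>. When \<open>u\<close> and \<open>v\<close> have the same stabilizer, two such
    choices act alike on \<open>v\<close>, so \<open>move\<close> sends g u to g v.\<close>
  define move where
    "move u v z = shift G (SOME g. g \<in> carrier G \<and> shift G g u = z) v"
    for u v z :: "'a \<Rightarrow> 'c"
  have move: "move u v (shift G g u) = shift G g v"
    if g: "g \<in> carrier G" and uv: "u \<in> ?X" "v \<in> ?X"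
      and "stabilizer G (shift G) u = stabilizer G (shift G) v" for u v g
  proof -
    define h where "h = (SOME h. h \<in> carrier G \<and> shift G h u = shift G g u)"
    have "h \<in> carrier G \<and> shift G h u = shift G g u"
      unfolding h_def by (rule someI[of _ g]) (use g in simp)
    then have "shift G h v = shift G g v"
      using that shift_eq_shift_iff by metis
    then show ?thesis by (simp add: move_def h_def)
  qed
  define \<tau> where "\<tau> = (\<lambda>z\<in>?X. if z \<in> ?O x then move x y z
                          else if z \<in> ?O y then move y x z else z)"
  \<comment> \<open>Disjointness of the orbits ensures that points of the orbit of \<open>y\<close>
    reach the second branch of \<open>\<tau>\<close>.\<close>
  have disj: "z \<notin> ?O y" if "z \<in> ?O x" for z
    using that ne orbit_shift_eq x y by metis
  have \<tau>_x: "\<tau> (shift G g x) = shift G g y" if "g \<in> carrier G" for g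
    using that x y move[OF that x y stab] by (auto simp: \<tau>_def shift_closed orbit_def)
  have \<tau>_y: "\<tau> (shift G g y) = shift G g x" if g: "g \<in> carrier G" for g
  proof -
    have "shift G g y \<in> ?O y" using g by (auto simp: orbit_def)
    with disj show ?thesis
      using move[OF g y x stab[symmetric]] g y by (auto simp: \<tau>_def shift_closed)
  qed
  have \<tau>_z: "\<tau> z = z" if "z \<in> ?X" "z \<notin> ?O x" "z \<notin> ?O y" for z
    using that by (simp add: \<tau>_def)
  have cases: thesis
    if "\<And>g. g \<in> carrier G \<Longrightarrow> z = shift G g x \<Longrightarrow> thesis"
      and "\<And>g. g \<in> carrier G \<Longrightarrow> z = shift G g y \<Longrightarrow> thesis"
      and "z \<notin> ?O x \<Longrightarrow> z \<notin> ?O y \<Longrightarrow> thesis" for z thesis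
    using that by (auto simp: orbit_def)
  have closed: "\<tau> z \<in> ?X" if "z \<in> ?X" for z
    by (rule cases[of z]) (use that x y in \<open>simp_all add: \<tau>_x \<tau>_y \<tau>_z shift_closed\<close>)
  have invol: "\<tau> (\<tau> z) = z" if "z \<in> ?X" for z
    by (rule cases[of z]) (use that in \<open>simp_all add: \<tau>_x \<tau>_y \<tau>_z\<close>)
  have equiv: "\<tau> (shift G h z) = shift G h (\<tau> z)" if h: "h \<in> carrier G" and z: "z \<in> ?X" for h z
  proof (rule cases[of z])
    assume z': "z \<notin> ?O x" "z \<notin> ?O y"
    \<comment> \<open>The complement of an orbit is shift-invariant, so \<open>\<tau>\<close> also
      fixes the shifted point.\<close>
    have "shift G h z \<notin> ?O u" if "u \<in> ?X" "z \<notin> ?O u" for u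
    proof
      assume "shift G h z \<in> ?O u"
      moreover have "shift G h z \<in> ?O z" using h by (auto simp: orbit_def)
      ultimately have "?O z = ?O u" using orbit_shift_eq that(1) z by metis
      with orbit_shift_refl[OF z] that(2) show False by simp
    qed
    with x y z z' show ?thesis by (simp add: \<tau>_z shift_closed h)
  qed (use h in \<open>simp_all add: \<tau>_x \<tau>_y shift_shift\<close>)
  have "\<tau> \<in> carrier (CA G A)"
    using closed equiv by (simp add: carrier_CA[OF fin] equivariant_maps_def) (simp add: \<tau>_def)
  \<comment> \<open>\<open>\<tau>\<close> is an involution, hence a unit with itself as
    inverse.\<close>
  moreover have "compose ?X \<tau> \<tau> = (\<lambda>z\<in>?X. z)"
    using invol by (auto simp: compose_def)
  then have "\<tau> \<otimes>\<^bsub>CA G A\<^esub> \<tau> = \<one>\<^bsub>CA G A\<^esub>" by (simp add: CA_def)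
  ultimately have "\<tau> \<in> carrier (ICA G A)"
    by (auto simp: ICA_simps Units_def)
  moreover have "\<tau> x = y" "\<tau> y = x"
    using \<tau>_x[OF one_closed] \<tau>_y[OF one_closed] x y by (simp_all add: shift_one)
  ultimately show thesis using \<tau>_z that by blast
qed

text \<open>Supplies the dual elements for the rank bound: a transposition is odd, the identity is
  even. At a class not containing the common stabilizer, neither exchanged orbit is among those
  permuted.\<close>

lemma exists_class_transposition:
  assumes fin: "finite (carrier G)"
    and x: "x \<in> configurations G A" and y: "y \<in> configurations G A"
    and stab: "stabilizer G (shift G) x = stabilizer G (shift G) y"
    and ne: "orbit G (shift G) x \<noteq> orbit G (shift G) y"
  obtains \<tau> where "\<tau> \<in> carrier (ICA G A)"
    and "\<And>c. c \<in> orbits G {H. subgroup H G} (subgroup_conjugation G) \<Longrightarrow>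
           induced_perm G A c \<tau> =
             (if stabilizer G (shift G) x \<in> c
              then transpose (orbit G (shift G) x) (orbit G (shift G) y) else id)"
proof -
  let ?O = "\<lambda>z. orbit G (shift G) z"
  obtain \<tau> where \<tau>: "\<tau> \<in> carrier (ICA G A)" "\<tau> x = y" "\<tau> y = x"
    and fixed: "\<And>z. z \<in> configurations G A \<Longrightarrow> z \<notin> ?O x \<Longrightarrow> z \<notin> ?O y \<Longrightarrow> \<tau> z = z"
    using exists_orbit_swap[OF assms] by blast
  have image: "\<tau> ` ?O z = transpose (?O x) (?O y) (?O z)" if z: "z \<in> configurations G A" for z
  proof -
    have swap: "\<tau> ` ?O x = ?O y" "\<tau> ` ?O y = ?O x"
      using image_orbit_ICA[OF fin \<tau>(1)] x y \<tau>(2,3) by simp_all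
    consider "z \<in> ?O x" | "z \<in> ?O y" | "z \<notin> ?O x" "z \<notin> ?O y" by blast
    then show ?thesis
    proof cases
      case 1
      with swap show ?thesis by (simp add: orbit_shift_eq[OF x])
    next
      case 2
      with swap show ?thesis by (simp add: orbit_shift_eq[OF y])
    next
      case 3
      then have "?O z \<noteq> ?O x" "?O z \<noteq> ?O y"
        using orbit_shift_refl[OF z] by auto
      moreover have "\<tau> ` ?O z = ?O z"
        using image_orbit_ICA[OF fin \<tau>(1) z] fixed[OF z 3] by simp
      ultimately show ?thesis by (simp add: transpose_def)
    qed
  qed
  have "induced_perm G A c \<tau> P =
          (if stabilizer G (shift G) x \<in> c then transpose (?O x) (?O y) else id) P"
    if c: "c \<in> orbits G {H. subgroup H G} (subgroup_conjugation G)" for c P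
  proof (cases "P \<in> orbits_of_type G A c")
    case True
    then obtain z where z: "z \<in> configurations G A" "stabilizer G (shift G) z \<in> c" "P = ?O z"
      by (auto simp: orbits_of_type_iff)
    \<comment> \<open>If \<open>P\<close> were the orbit of \<open>u\<close>, its point
      \<open>z\<close> with stabilizer in \<open>c\<close> would force the stabilizer of
      \<open>u\<close> into \<open>c\<close>. Applied to \<open>x\<close> and \<open>y\<close>, this
      shows that \<open>P\<close> is not exchanged when their stabilizer lies outside
      \<open>c\<close>.\<close>
    have "P \<noteq> ?O u" if "u \<in> configurations G A" "stabilizer G (shift G) u \<notin> c" for u
      using stabilizer_in_subgroup_class[OF c that(1), of z] orbit_shift_refl[OF z(1)] z that
      by auto
    then show ?thesis
      using True image[OF z(1)] z(3) x y stab by (auto simp: induced_perm_def)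
  next
    case False
    then have "stabilizer G (shift G) x \<in> c \<Longrightarrow> P \<noteq> ?O x \<and> P \<noteq> ?O y"
      using x y stab by (auto simp: orbits_of_type_iff)
    with False show ?thesis by (simp add: induced_perm_def)
  qed
  then show thesis using that[OF \<tau>(1)] by blast
qed

section \<open>Configurations with a prescribed stabilizer\<close>

lemma two_valued_closed:
  "a \<in> A \<Longrightarrow> b \<in> A \<Longrightarrow> two_valued G H a b \<in> configurations G A"
  by (auto simp: two_valued_def configurations_def)

text \<open>Left multiplication by an element of \<open>H\<close> preserves \<open>H\<close> and its
  complement. Conversely, the configuration shifted by g takes at g the value the original has at
  \<open>\<one>\<close>, namely \<open>a\<close>, so invariance puts g in \<open>H\<close>.\<close>

lemma stabilizer_two_valued:
  assumes H: "subgroup H G" and ab: "a \<noteq> b"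
  shows "stabilizer G (shift G) (two_valued G H a b) = H"
proof -
  interpret H: subgroup H G by (rule H)
  have "shift G g (two_valued G H a b) = two_valued G H a b \<longleftrightarrow> g \<in> H"
    if g: "g \<in> carrier G" for g
  proof
    assume "shift G g (two_valued G H a b) = two_valued G H a b"
    from fun_cong[OF this, of g] have "two_valued G H a b g = a"
      using g by (simp add: shift_def two_valued_def)
    then show "g \<in> H"
      using g ab by (simp add: two_valued_def split: if_splits)
  next
    assume gH: "g \<in> H"
    have "inv g \<otimes> h \<in> H \<longleftrightarrow> h \<in> H" if h: "h \<in> carrier G" for h
    proof
      assume "inv g \<otimes> h \<in> H"
      then have "g \<otimes> (inv g \<otimes> h) \<in> H" using gH by simp
      then show "h \<in> H" using g h by (simp add: m_assoc[symmetric])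
    qed (use gH in simp)
    then show "shift G g (two_valued G H a b) = two_valued G H a b"
      using g by (auto simp: shift_def two_valued_def)
  qed
  then show ?thesis using H.subset by (auto simp: stabilizer_def)
qed

lemma exists_two_orbits_with_stabilizer:
  assumes fin: "finite (carrier G)" and H: "subgroup H G" and A: "card A \<ge> 2"
    and idx: "card A \<noteq> 2 \<or> card (rcosets H) \<noteq> 2"
  obtains x y where "x \<in> configurations G A" "y \<in> configurations G A"
    "stabilizer G (shift G) x = H" "stabilizer G (shift G) y = H"
    "orbit G (shift G) x \<noteq> orbit G (shift G) y"
proof -
  interpret H: subgroup H G by (rule H)
  obtain a b where ab: "a \<in> A" "b \<in> A" "a \<noteq> b"
  proof -
    obtain B where "B \<subseteq> A" "card B = 2"
      using obtain_subset_with_card_n[OF A] by blast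
    then show thesis using that by (auto simp: card_2_iff)
  qed
  let ?x = "two_valued G H a b"
  note pair = that
  \<comment> \<open>Any \<open>two_valued G H c d\<close> with distinct values has stabilizer
    \<open>H\<close>, so it only remains to keep it out of the orbit of \<open>?x\<close>.\<close>
  have suff: thesis if c: "c \<in> A" and d: "d \<in> A" "c \<noteq> d"
    and no: "\<And>g. g \<in> carrier G \<Longrightarrow> two_valued G H c d \<noteq> shift G g ?x" for c d
  proof (rule pair[of ?x "two_valued G H c d"])
    have "two_valued G H c d \<notin> orbit G (shift G) ?x" using no by (auto simp: orbit_def)
    then show "orbit G (shift G) ?x \<noteq> orbit G (shift G) (two_valued G H c d)"
      using orbit_shift_refl[OF two_valued_closed[OF c d(1)]] by auto
  qed (use ab c d H in \<open>simp_all add: two_valued_closed stabilizer_two_valued\<close>)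
  text \<open>For a third symbol \<open>c\<close>, \<open>two_valued G H c b\<close> takes a value that \<open>?x\<close> does not take;
    with two symbols, a shift carrying \<open>?x\<close> to \<open>two_valued G H b a\<close> would give a bijection of
    \<open>H\<close> with its complement, forcing index 2.\<close>
  show thesis
  proof (cases "card A = 2")
    case False
    then have "A \<noteq> {a, b}" using ab(3) by auto
    then obtain c where c: "c \<in> A" "c \<noteq> a" "c \<noteq> b"
      using ab(1,2) by blast
    show thesis
    proof (rule suff[of c b])
      fix g assume g: "g \<in> carrier G"
      have "two_valued G H c b \<one> = c" by (simp add: two_valued_def)
      moreover have "shift G g ?x \<one> \<noteq> c"
        using c g by (simp add: two_valued_def shift_def)
      ultimately show "two_valued G H c b \<noteq> shift G g ?x" by metis
    qed (use ab c in auto)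
  next
    case True
    show thesis
    proof (rule suff[of b a])
      fix g assume g: "g \<in> carrier G"
      show "two_valued G H b a \<noteq> shift G g ?x"
      proof
        assume eq: "two_valued G H b a = shift G g ?x"
        \<comment> \<open>Comparing values at each \<open>h\<close> shows that left translation by
          \<open>inv g\<close> exchanges \<open>H\<close> with its complement.\<close>
        have iff: "inv g \<otimes> h \<in> H \<longleftrightarrow> h \<in> carrier G - H" if "h \<in> carrier G" for h
          using fun_cong[OF eq, of h] that g ab(3)
          by (simp add: two_valued_def shift_def split: if_splits)
        have "bij_betw (\<lambda>h. g \<otimes> h) H (carrier G - H)"
        proof (rule bij_betw_byWitness[where f' = "\<lambda>h. inv g \<otimes> h"])
          show "(\<lambda>h. g \<otimes> h) ` H \<subseteq> carrier G - H"
          proof (rule image_subsetI)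
            fix h assume h: "h \<in> H"
            then have "inv g \<otimes> (g \<otimes> h) = h"
              using g by (simp add: m_assoc[symmetric])
            then show "g \<otimes> h \<in> carrier G - H"
              using iff[of "g \<otimes> h"] g h by simp
          qed
          show "(\<lambda>h. inv g \<otimes> h) ` (carrier G - H) \<subseteq> H"
            using iff by auto
        qed (use g H.mem_carrier in \<open>auto simp: m_assoc[symmetric]\<close>)
        then have "card H = card (carrier G - H)" by (rule bij_betw_same_card)
        also have "\<dots> = card (carrier G) - card H"
          using fin H.subset by (simp add: card_Diff_subset finite_subset)
        \<comment> \<open>The difference is taken in the naturals; \<open>card_mono\<close> supplies
          |H| <= |G|, so that it can be undone.\<close>
        finally have "card (carrier G) = 2 * card H"
          using card_mono[OF fin H.subset] by simp
        moreover have "card H > 0"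
          using fin H.subset H.one_closed by (metis card_gt_0_iff empty_iff finite_subset)
        ultimately have "card (rcosets H) = 2"
          using lagrange[OF H] by (simp add: order_def)
        with True idx show False by simp
      qed
    qed (use ab in auto)
  qed
qed

end

section \<open>Parities indexed by conjugacy classes of subgroups\<close>

theorem proposition2:
  fixes G :: "('a, 'm) monoid_scheme" and A :: "'b set" and q :: nat
  assumes "group G" and "finite (carrier G)"
    and "finite A" and "card A = q" and "q \<ge> 2"
  shows "monoid_rank (ICA G A) \<ge>
    (if q = 2 then num_subgroup_classes G - num_subgroup_classes_index G 2
     else num_subgroup_classes G)"
proof -
  interpret group G by fact
  interpret conj: group_action G "{H. subgroup H G}" "subgroup_conjugation G"
    by (rule subgroup_conjugation_action)
  define R where "R = orbits G {H. subgroup H G} (subgroup_conjugation G)"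
  define R2 where
    "R2 = orbits G {H. subgroup H G \<and> card (rcosets\<^bsub>G\<^esub> H) = 2} (subgroup_conjugation G)"
  \<comment> \<open>The classes for which two orbits with a common stabilizer will be found; each
    contributes one factor Z/2.\<close>
  define C where "C = (if q = 2 then R - R2 else R)"
  have "finite {H. subgroup H G}"
    using assms(2) by (rule finite_subset[rotated, OF finite_Pow_iff[THEN iffD2]])
      (auto dest: subgroup.subset)
  then have finR: "finite R" "finite R2"
    unfolding R_def R2_def orbits_def by simp_all
  obtain T where T: "finite T" "card T = monoid_rank (ICA G A)" "generates_monoid (ICA G A) T"
    using monoid_rank_attained[OF monoid_ICA finite_ICA] assms(2,3) by blast
  have "card C \<le> card T"
  proof (rule card_generators_ge_independent_parities[OF monoid_ICA[OF assms(2)] T(1,3),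
        where p = "\<lambda>c \<tau>. \<not> evenperm (induced_perm G A c \<tau>)"])
    show "finite C" using finR by (simp add: C_def)
  next
    fix c \<tau> \<sigma> assume "\<tau> \<in> carrier (ICA G A)" "\<sigma> \<in> carrier (ICA G A)"
    then show "\<not> evenperm (induced_perm G A c (\<tau> \<otimes>\<^bsub>ICA G A\<^esub> \<sigma>)) \<longleftrightarrow>
        ((\<not> evenperm (induced_perm G A c \<tau>)) \<noteq> (\<not> evenperm (induced_perm G A c \<sigma>)))"
      using assms(2,3)
      by (simp add: induced_perm_mult evenperm_comp permutation_induced_perm)
  next
    fix c assume c: "c \<in> C"
    then obtain H where H: "subgroup H G" "c = orbit G (subgroup_conjugation G) H"
      by (auto simp: C_def R_def orbits_def split: if_splits)
    have Hc: "H \<in> c" using H conj.orbit_refl by simp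
    \<comment> \<open>If q = 2 and \<open>H\<close> had index 2, its class \<open>c\<close> would
      belong to \<open>R2\<close>, which \<open>C\<close> excludes.\<close>
    have "card A \<noteq> 2 \<or> card (rcosets\<^bsub>G\<^esub> H) \<noteq> 2"
      using c H assms(4) by (auto simp: C_def R2_def orbits_def split: if_splits)
    then obtain x y where xy: "x \<in> configurations G A" "y \<in> configurations G A"
      "stabilizer G (shift G) x = H" "stabilizer G (shift G) y = H"
      "orbit G (shift G) x \<noteq> orbit G (shift G) y"
      using exists_two_orbits_with_stabilizer[OF assms(2) H(1)] assms(4,5) by metis
    then obtain \<tau> where \<tau>: "\<tau> \<in> carrier (ICA G A)"
      "\<And>d. d \<in> R \<Longrightarrow> induced_perm G A d \<tau> =
         (if H \<in> d then transpose (orbit G (shift G) x) (orbit G (shift G) y) else id)"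
      using exists_class_transposition[OF assms(2) xy(1,2)] unfolding R_def by metis
    have "\<not> evenperm (induced_perm G A d \<tau>) \<longleftrightarrow> d = c" if "d \<in> C" for d
    proof -
      have R: "d \<in> R" "c \<in> R" using that c by (auto simp: C_def split: if_splits)
      \<comment> \<open>Distinct conjugacy classes are disjoint, so \<open>c\<close> is the only one
        containing \<open>H\<close>, and the automaton is odd there alone.\<close>
      then have "H \<in> d \<longleftrightarrow> d = c"
        using conj.disjoint_union[of c d] Hc by (auto simp: R_def)
      with \<tau>(2)[OF R(1)] xy(5) show ?thesis by (simp add: evenperm_swap)
    qed
    with \<tau>(1) show "\<exists>\<tau>\<in>carrier (ICA G A).
        \<forall>d\<in>C. \<not> evenperm (induced_perm G A d \<tau>) \<longleftrightarrow> d = c" by blast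
  qed
  \<comment> \<open>For q = 2 the stated bound is a difference of cardinalities, at most the
    cardinality of the set difference \<open>C\<close>.\<close>
  moreover have "card R - card R2 \<le> card (R - R2)"
    by (rule diff_card_le_card_Diff[OF finR(2)])
  ultimately show ?thesis
    using T(2) by (auto simp: C_def R_def R2_def num_subgroup_classes_def
        num_subgroup_classes_index_def split: if_splits)
qed

end
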